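(* Let $c\ge1$ be an integer. Then $$\operatorname{ch}_{\mathsf q}V_{c,1}=\sum_{r\geq 0}\frac{q^{r^2}}{(1-q)(1-q^2)\cdots(1-q^r)}\,c^r .$$
   Context: Operators. Let $\mathbb F=\mathbb C(q^{1/2})$ and $\mathsf q=q^2$. For an $\mathbb F$-vector space $L$, $L((z_1,\dots,z_m))$ is the space of formal Laurent series with coefficients in $L$ and exponents bounded below in each variable; $\mathcal E(L)=\operatorname{Hom}(L,L((z)))$, $\mathcal E(L)_t=\mathcal E(L)\otimes\mathbb F[t]$; $a(z)\otimes t^\alpha$ is homogeneous of weight $\alpha$. $[r]_{\mathsf q}=(\mathsf q^r-1)/(\mathsf q-1)$, with corresponding factorials $[r]_{\mathsf q}!$ and binomials $\binom ml_{\mathsf q}=[m]_{\mathsf q}\cdots[m-l+1]_{\mathsf q}/[l]_{\mathsf q}!$. The $\mathsf q$-derivative is $a^{[1]}(z)=\frac{a(z\mathsf q)-a(z)}{z(\mathsf q-1)}$, $a^{[r]}$ its $r$-th iterate. $\mathbb F[z]_0=\{p\in\mathbb F[z]:p(1)=1,\ p(\mathsf q^n)\ne0\ \forall n\in\mathbb Z_{\ge0}\}$. A sequence $(a_1(z)\otimes t^{\alpha_1},\dots,a_m(z)\otimes t^{\alpha_m})$ is quasi-commutative if for some $p\in\mathbb F[z]_0$ the series $\bigl(\prod_{i<j}p(z_j/z_i)\bigr)a_1(z_1)a_2(z_2\mathsf q^{\alpha_1})\cdots a_m(z_m\mathsf q^{\alpha_1+\cdots+\alpha_{m-1}})$ lies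 in $\operatorname{Hom}(L,L((z_1,\dots,z_m)))$; a sequence of general elements is quasi-commutative if all choices of homogeneous components are. For a quasi-commutative pair and $r\ge0$, $(a(z)\otimes t^\alpha)_{-r-1}(b(z)\otimes t^\beta)=\lim_{z_1\to z}\frac{p(z/z_1)}{[r]_{\mathsf q}!}a^{[r]}(z_1)b(z\mathsf q^{\alpha+r})\otimes t^{\alpha+\beta+r}$, with $p\in\mathbb F[z]_0$ any polynomial such that $p(z/z_1)a^{[r]}(z_1)b(z\mathsf q^{\alpha+r})\in\operatorname{Hom}(L,L((z_1,z)))$ (the limit means setting $z_1=z$; the result is independent of $p$); for $r<0$ the product is $0$; extend bilinearly. $Y(a,z_0)b=\sum_r(a_rb)z_0^{-r-1}$; $\mathbf 1=1\otimes1$ (identity operator tensor $1$). Iterated products are nested to the right. A graded nonlocal $\mathsf q$-vertex algebra is a $\mathbb Z$-graded space $V=\coprod_uV_{(u)}$ with a linear map $Y(\cdot,z_0):V\to(\operatorname{End}V)[[z_0^{\pm1}]]$, $Y(a,z_0)=\sum_ra_rz_0^{-r-1}$, and $\mathbf 1\in V$ such that: $a_rb=0$ for $r\gg0$; $Y(\mathbf 1,z_0)=1_V$; $Y(a,z_0)\mathbf 1\in V[[z_0]]$ has constant term $a$; $a_rV_{(s)}\subseteq V_{(s+u-r-1)}$ for $a\in V_{(u)}$; and for $a\in V_{(u)}$, $b,c\in V$, $r,s\in\mathbb Z$: $(a_rb)_sc=\sum_{l\ge0}\binom{l-r-1}{l}_{\mathsf q}\mathsf q^{(s+l+1)(r-u+1)}a_{r-l}(b_{s+l}c)$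 (this is $Y(a,z_0+z_2)Y(b,z_2\mathsf q^u)c=Y(Y(a,z_0)b,z_2)c$ with $z_2z_0=\mathsf qz_0z_2$). A graded nonlocal $\mathsf q$-vertex algebra $V\subseteq\mathcal E(L)_t$ is a subspace whose pairs are quasi-commutative, containing $\mathbf 1$, closed under all products, satisfying these axioms with $Y(a,z_0)b=\sum_{r\in\mathbb Z}(a_rb)z_0^{-r-1}$ formed from the products $a_rb$ of quasi-commutative pairs in $\mathcal E(L)_t$, with $\mathbf 1=1\otimes1$ (identity operator of $L$ tensor $1$), and with $V_{(u)}=\{a(z)\otimes t^u\in V\}$. The module $L$ for $U_q(\widehat{\mathfrak{sl}}_2)$. Let $[r]=(q^r-q^{-r})/(q-q^{-1})$. $M(1)$ is the polynomial algebra over $\mathbb F$ in $a(-r)$, $r\ge1$; $a(-r)$ acts by multiplication and $a(r)$, $r\ge1$, as the derivation with $[a(r),a(-s)]=\delta_{rs}\frac{[2r][r]}{r}$. Let $Q=\mathbb Z\alpha_1$, $(\alpha_1,\alpha_1)=2$, $\mathbb C\{Q\}$ its group algebra (scalars extended to $\mathbb F$) with basis $e^\beta$, $z^{\partial_{\alpha_1}}e^\beta=z^{(\alpha_1,\beta)}e^\beta$, $Ke^\beta=q^{(\alpha_1,\beta)}e^\beta$. On $L_0=M(1)\otimes\mathbb C\{Q\}$ (the Frenkel–Jing module of highest weight $\Lambda_0$) put $$x^+(z)=\exp\Bigl(\sum_{r\ge1}\tfrac{q^{-r/2}}{[r]}a(-r)z^r\Bigr)\exp\Bigl(-\sum_{r\ge1}\tfrac{q^{-r/2}}{[r]}a(r)z^{-r}\Bigr)\otimes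 e^{\alpha_1}z^{\partial_{\alpha_1}},\quad \phi(z)=K^{-1}\exp\Bigl(-(q-q^{-1})\sum_{r\ge1}a(-r)z^r\Bigr).$$ On $L=(L_0)^{\otimes c}$ the current $x(z)=x_1^+(z)\in\mathcal E(L)$ acts (Drinfeld coproduct) by $$x(z)=\sum_{l=1}^c\phi(zq^{1/2})\otimes\phi(zq^{3/2})\otimes\cdots\otimes\phi(zq^{l-3/2})\otimes x^+(zq^{l-1})\otimes1^{\otimes(c-l)}.$$ $V_{c,1}\subseteq\mathcal E(L)_t$ is the smallest graded nonlocal $\mathsf q$-vertex algebra containing $x(z)\otimes t$ (it exists). For $m\ge1$, $x_m(z,t)=\underbrace{(x(z)\otimes t)_{-1}\cdots(x(z)\otimes t)_{-1}}_{m}\mathbf 1\in V_{c,1}$. Character. It is known that the elements $$x_{m_1}(z,t)_{r_1}\cdots x_{m_k}(z,t)_{r_k}\mathbf 1,\qquad r_1,\dots,r_{k-1}\le-2,\ r_k\le-1,\ 1\le m_j\le c,\ k\in\mathbb Z_{\ge0},$$ (distinct for distinct data; $\mathbf 1$ for $k=0$) form a basis $\mathcal B_{c,1}$ of $V_{c,1}$. For such a basis element put $\deg_{\mathsf q}=-(r_1+2r_2+\cdots+kr_k)$, and $\deg_{\mathsf q}\mathbf 1=0$. Let $(V_{c,1})_r$ be the span of the basis elements of degree $r$; these spaces are finite-dimensional and $V_{c,1}=\coprod_{r\ge0}(V_{c,1})_r$. Define $\operatorname{ch}_{\mathsf q}V_{c,1}=\sum_{r\ge0}\dim(V_{c,1})_r\,q^r$,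 where in the character $q$ is a formal variable unrelated to the parameter $\mathsf q$ (and to the quantum parameter). *)

theory Defs
  imports
    "HOL-Library.Poly_Mapping"
    "HOL-Library.Function_Algebras"
    "HOL-Library.Cardinality"
    "HOL-Computational_Algebra.Computational_Algebra"
begin

section \<open>The ground field and $\mathsf q$-numbers\<close>

text \<open>The field of rational functions over the complex numbers in an indeterminate written
  \<open>q\<^sup>1\<^sup>/\<^sup>2\<close>. The letter \<open>qq\<close> stands for the sans-serif parameter, which is the square of
  the quantum parameter \<open>qpar\<close>.\<close>

type_synonym qfield = "complex poly fract"

definition qhalf :: qfield where "qhalf = Fract [:0, 1:] 1"
definition qpar :: qfield where "qpar = qhalf ^ 2"
definition qq :: qfield where "qq = qpar ^ 2"

definition sqint :: "int \<Rightarrow> qfield" where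
  "sqint r = (qq powi r - 1) / (qq - 1)"

definition sqfact :: "nat \<Rightarrow> qfield" where
  "sqfact r = (\<Prod>i=1..r. sqint (int i))"

definition sqbinom :: "int \<Rightarrow> nat \<Rightarrow> qfield" where
  "sqbinom m l = (\<Prod>i<l. sqint (m - int i)) / sqfact l"

text \<open>The balanced quantum integer, used for the Heisenberg algebra.\<close>

definition qint :: "int \<Rightarrow> qfield" where
  "qint r = (qpar powi r - qpar powi (- r)) / (qpar - inverse qpar)"

definition F0 :: "qfield poly set" where
  "F0 = {p. poly p 1 = 1 \<and> (\<forall>n::nat. poly p (qq ^ n) \<noteq> 0)}"


section \<open>Graded nonlocal $\mathsf q$-vertex algebras\<close>

text \<open>\<open>V\<close> is the carrier, \<open>G u\<close> the homogeneous subspace of degree \<open>u\<close>, and \<open>prd a r b\<close> is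
  \<open>a\<^sub>r b\<close>. The sum over \<open>l\<close> in \<open>associativity\<close> has only finitely many nonzero terms because of
  \<open>truncation\<close>.\<close>

locale graded_nonlocal_qva = vector_space scale
  for scale :: "qfield \<Rightarrow> 'v::ab_group_add \<Rightarrow> 'v" +
  fixes V :: "'v set" and G :: "int \<Rightarrow> 'v set"
    and prd :: "'v \<Rightarrow> int \<Rightarrow> 'v \<Rightarrow> 'v" and vac :: 'v
  assumes subspace_V: "subspace V"
    and subspace_G: "subspace (G u)"
    and G_subset: "G u \<subseteq> V"
    and decomposition:
      "a \<in> V \<Longrightarrow> \<exists>!f :: int \<Rightarrow>\<^sub>0 'v.
         (\<forall>u. Poly_Mapping.lookup f u \<in> G u) \<and>
         a = (\<Sum>u\<in>Poly_Mapping.keys f. Poly_Mapping.lookup f u)"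
    and prd_closed: "a \<in> V \<Longrightarrow> b \<in> V \<Longrightarrow> prd a r b \<in> V"
    and prd_add_left:
      "a \<in> V \<Longrightarrow> a' \<in> V \<Longrightarrow> b \<in> V \<Longrightarrow> prd (a + a') r b = prd a r b + prd a' r b"
    and prd_scale_left: "a \<in> V \<Longrightarrow> b \<in> V \<Longrightarrow> prd (scale k a) r b = scale k (prd a r b)"
    and prd_add_right:
      "a \<in> V \<Longrightarrow> b \<in> V \<Longrightarrow> b' \<in> V \<Longrightarrow> prd a r (b + b') = prd a r b + prd a r b'"
    and prd_scale_right: "a \<in> V \<Longrightarrow> b \<in> V \<Longrightarrow> prd a r (scale k b) = scale k (prd a r b)"
    and vac_in_V: "vac \<in> V"
    and truncation: "a \<in> V \<Longrightarrow> b \<in> V \<Longrightarrow> \<exists>N. \<forall>r\<ge>N. prd a r b = 0"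
    and vac_left: "b \<in> V \<Longrightarrow> prd vac r b = (if r = - 1 then b else 0)"
    and creation: "a \<in> V \<Longrightarrow> prd a (- 1) vac = a"
    and creation_nonneg: "a \<in> V \<Longrightarrow> r \<ge> 0 \<Longrightarrow> prd a r vac = 0"
    and grading: "a \<in> G u \<Longrightarrow> b \<in> G s \<Longrightarrow> prd a r b \<in> G (s + u - r - 1)"
    and associativity:
      "a \<in> G u \<Longrightarrow> b \<in> V \<Longrightarrow> c \<in> V \<Longrightarrow>
         prd (prd a r b) s c =
         Sum_any (\<lambda>l::nat. scale (sqbinom (int l - r - 1) l *
                                 qq powi ((s + int l + 1) * (r - u + 1)))
                          (prd a (r - int l) (prd b (s + int l) c)))"


section \<open>Currents on a vector space\<close>

text \<open>A current \<open>a(z)\<close> is given by its coefficients: \<open>a n\<close> is the coefficient of \<open>z\<^sup>n\<close>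
  (not \<open>z\<^sup>-\<^sup>n\<^sup>-\<^sup>1\<close>). Likewise an operator-valued formal series in \<open>z\<^sub>0, \<dots>, z\<^sub>m\<^sub>-\<^sub>1\<close> is a function of
  the exponent vector \<open>n\<close>, where \<open>n\<close> is supported in \<open>{..<m}\<close>.\<close>

type_synonym 'l current = "int \<Rightarrow> 'l \<Rightarrow> 'l"
type_synonym 'l dist = "(nat \<Rightarrow>\<^sub>0 int) \<Rightarrow> 'l \<Rightarrow> 'l"

locale currents = vector_space scale
  for scale :: "qfield \<Rightarrow> 'l::ab_group_add \<Rightarrow> 'l" (infixr "*s" 75)
begin

definition E :: "'l current set" where
  "E = {a. (\<forall>n. Vector_Spaces.linear scale scale (a n)) \<and>
           (\<forall>v. \<exists>N. \<forall>n<N. a n v = 0)}"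

definition Hom_Laurent :: "nat \<Rightarrow> 'l dist set" where
  "Hom_Laurent m =
     {A. (\<forall>n. Poly_Mapping.keys n \<subseteq> {..<m} \<longrightarrow> Vector_Spaces.linear scale scale (A n)) \<and>
         (\<forall>v. \<exists>N. \<forall>n. Poly_Mapping.keys n \<subseteq> {..<m} \<longrightarrow> A n v \<noteq> 0 \<longrightarrow>
                (\<forall>i<m. N \<le> Poly_Mapping.lookup n i))}"

text \<open>\<open>dil k a\<close> is \<open>a(kz)\<close>; \<open>qder a\<close> is the $\mathsf q$-derivative
  \<open>(a(z qq) - a(z)) / (z (qq - 1))\<close>.\<close>

definition dil :: "qfield \<Rightarrow> 'l current \<Rightarrow> 'l current" where
  "dil k a = (\<lambda>n v. (k powi n) *s a n v)"

definition qder :: "'l current \<Rightarrow> 'l current" where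
  "qder a = (\<lambda>n v. (1 / (qq - 1)) *s (dil qq a (n + 1) v - a (n + 1) v))"

text \<open>\<open>cprod [a\<^sub>0, \<dots>, a\<^sub>m\<^sub>-\<^sub>1]\<close> is \<open>a\<^sub>0(z\<^sub>0) \<dots> a\<^sub>m\<^sub>-\<^sub>1(z\<^sub>m\<^sub>-\<^sub>1)\<close>.\<close>

definition cprod :: "'l current list \<Rightarrow> 'l dist" where
  "cprod as n = foldr (\<lambda>i T. (as ! i) (Poly_Mapping.lookup n i) \<circ> T) [0..<length as] id"

text \<open>Laurent polynomials in the variables \<open>z\<^sub>i\<close> are finitely supported functions on exponent
  vectors; \<open>lmul\<close> is their multiplication on formal series and \<open>at_ratio p j i\<close> is \<open>p(z\<^sub>j / z\<^sub>i)\<close>.\<close>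

definition lmul :: "((nat \<Rightarrow>\<^sub>0 int) \<Rightarrow>\<^sub>0 qfield) \<Rightarrow> 'l dist \<Rightarrow> 'l dist" where
  "lmul P A = (\<lambda>n v. \<Sum>e\<in>Poly_Mapping.keys P. Poly_Mapping.lookup P e *s A (n - e) v)"

definition at_ratio :: "qfield poly \<Rightarrow> nat \<Rightarrow> nat \<Rightarrow> ((nat \<Rightarrow>\<^sub>0 int) \<Rightarrow>\<^sub>0 qfield)" where
  "at_ratio p j i =
     (\<Sum>k\<le>degree p. Poly_Mapping.single
        (Poly_Mapping.single j (int k) - Poly_Mapping.single i (int k)) (coeff p k))"

definition qc_homogeneous :: "('l current \<times> nat) list \<Rightarrow> bool" where
  "qc_homogeneous xs \<longleftrightarrow>
     (\<exists>p\<in>F0.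
        lmul (\<Prod>(i, j)\<in>{(i, j). i < j \<and> j < length xs}. at_ratio p j i)
          (cprod (map (\<lambda>i. dil (qq ^ (\<Sum>h<i. snd (xs ! h))) (fst (xs ! i))) [0..<length xs]))
        \<in> Hom_Laurent (length xs))"

text \<open>The tensor product of the space of currents with the polynomials in \<open>t\<close>: finitely supported
  families of currents, with \<open>Poly_Mapping.single \<alpha> a\<close> in the role of \<open>a(z) \<otimes> t\<^sup>\<alpha>\<close>.\<close>

definition Et_carrier :: "(nat \<Rightarrow>\<^sub>0 'l current) set" where
  "Et_carrier = {A. \<forall>\<alpha>. Poly_Mapping.lookup A \<alpha> \<in> E}"

definition scale_t :: "qfield \<Rightarrow> (nat \<Rightarrow>\<^sub>0 'l current) \<Rightarrow> (nat \<Rightarrow>\<^sub>0 'l current)" where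
  "scale_t k A = Poly_Mapping.map (\<lambda>a n v. k *s a n v) A"

lemma lookup_scale_t:
  "Poly_Mapping.lookup (scale_t k A) \<alpha> n v = k *s Poly_Mapping.lookup A \<alpha> n v"
  by (simp add: scale_t_def Poly_Mapping.map.rep_eq when_def zero_fun_def)

sublocale Et: vector_space scale_t
  by unfold_locales
    (rule poly_mapping_eqI; simp add: fun_eq_iff lookup_scale_t lookup_add
       scale_right_distrib scale_left_distrib)+

definition quasi_commutative :: "(nat \<Rightarrow>\<^sub>0 'l current) list \<Rightarrow> bool" where
  "quasi_commutative As \<longleftrightarrow>
     (\<forall>\<alpha>s. length \<alpha>s = length As \<longrightarrow>
        qc_homogeneous (map2 (\<lambda>A \<alpha>. (Poly_Mapping.lookup A \<alpha>, \<alpha>)) As \<alpha>s))"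

text \<open>\<open>hprod r a \<alpha> b\<close> is the current in \<open>(a(z) \<otimes> t\<^sup>\<alpha>)\<^sub>-\<^sub>r\<^sub>-\<^sub>1 (b(z) \<otimes> t\<^sup>\<beta>)\<close>. In \<open>two_var\<close> the variable
  \<open>z\<^sub>1\<close> of the limit has index \<open>0\<close> and \<open>z\<close> has index \<open>1\<close>; setting \<open>z\<^sub>1 = z\<close> collects, for each
  exponent \<open>n\<close>, the (finitely many nonzero) coefficients of total exponent \<open>n\<close>.\<close>

definition two_var :: "nat \<Rightarrow> 'l current \<Rightarrow> nat \<Rightarrow> 'l current \<Rightarrow> qfield poly \<Rightarrow> 'l dist" where
  "two_var r a \<alpha> b p =
     lmul (at_ratio p 1 0) (cprod [(qder ^^ r) a, dil (qq ^ (\<alpha> + r)) b])"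

definition set_equal :: "'l dist \<Rightarrow> 'l current" where
  "set_equal A = (\<lambda>n v. Sum_any (\<lambda>k::int.
     A (Poly_Mapping.single 0 k + Poly_Mapping.single 1 (n - k)) v))"

definition hprod :: "nat \<Rightarrow> 'l current \<Rightarrow> nat \<Rightarrow> 'l current \<Rightarrow> 'l current" where
  "hprod r a \<alpha> b =
     (let p = SOME p. p \<in> F0 \<and> two_var r a \<alpha> b p \<in> Hom_Laurent 2
      in (\<lambda>n v. (1 / sqfact r) *s set_equal (two_var r a \<alpha> b p) n v))"

definition nth_prod ::
    "(nat \<Rightarrow>\<^sub>0 'l current) \<Rightarrow> int \<Rightarrow> (nat \<Rightarrow>\<^sub>0 'l current) \<Rightarrow> (nat \<Rightarrow>\<^sub>0 'l current)" where
  "nth_prod A n B =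
     (if n \<ge> 0 then 0
      else let r = nat (- n - 1) in
        \<Sum>\<alpha>\<in>Poly_Mapping.keys A. \<Sum>\<beta>\<in>Poly_Mapping.keys B.
          Poly_Mapping.single (\<alpha> + \<beta> + r)
            (hprod r (Poly_Mapping.lookup A \<alpha>) \<alpha> (Poly_Mapping.lookup B \<beta>)))"

definition id_current :: "'l current" where
  "id_current = (\<lambda>n v. if n = 0 then v else 0)"

definition vacuum :: "nat \<Rightarrow>\<^sub>0 'l current" where
  "vacuum = Poly_Mapping.single 0 id_current"

definition homog :: "(nat \<Rightarrow>\<^sub>0 'l current) set \<Rightarrow> int \<Rightarrow> (nat \<Rightarrow>\<^sub>0 'l current) set" where
  "homog V u = {A \<in> V. \<forall>\<alpha>\<in>Poly_Mapping.keys A. int \<alpha> = u}"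

definition qva_in_Et :: "(nat \<Rightarrow>\<^sub>0 'l current) set \<Rightarrow> bool" where
  "qva_in_Et V \<longleftrightarrow>
     V \<subseteq> Et_carrier \<and>
     (\<forall>A\<in>V. \<forall>B\<in>V. quasi_commutative [A, B]) \<and>
     graded_nonlocal_qva scale_t V (homog V) nth_prod vacuum"

end


section \<open>Vector spaces with a distinguished basis\<close>

text \<open>\<open>'b \<Rightarrow>\<^sub>0 qfield\<close> is the vector space with basis \<open>bas x\<close> for \<open>x :: 'b\<close>.\<close>

definition fscale :: "qfield \<Rightarrow> ('b \<Rightarrow>\<^sub>0 qfield) \<Rightarrow> ('b \<Rightarrow>\<^sub>0 qfield)" where
  "fscale k f = Poly_Mapping.map ((*) k) f"

lemma lookup_fscale: "Poly_Mapping.lookup (fscale k f) x = k * Poly_Mapping.lookup f x"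
  by (simp add: fscale_def Poly_Mapping.map.rep_eq when_def)

definition bas :: "'b \<Rightarrow> ('b \<Rightarrow>\<^sub>0 qfield)" where
  "bas x = Poly_Mapping.single x 1"

definition lin_ext :: "('b \<Rightarrow> ('d \<Rightarrow>\<^sub>0 qfield)) \<Rightarrow> ('b \<Rightarrow>\<^sub>0 qfield) \<Rightarrow> ('d \<Rightarrow>\<^sub>0 qfield)" where
  "lin_ext g f = (\<Sum>x\<in>Poly_Mapping.keys f. fscale (Poly_Mapping.lookup f x) (g x))"

global_interpretation cur: currents fscale
  by unfold_locales (rule poly_mapping_eqI; simp add: lookup_fscale lookup_add algebra_simps)+


section \<open>The Frenkel-Jing module and its tensor powers\<close>

text \<open>Monomials in the variables \<open>a(-1), a(-2), \<dots>\<close>: index \<open>i\<close> is the variable \<open>a(-(i+1))\<close>. The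
  operators \<open>heis_neg r\<close> and \<open>heis_pos r\<close> are \<open>a(-r)\<close> and \<open>a(r)\<close>, and are only used for \<open>r \<ge> 1\<close>.\<close>

type_synonym mono = "nat \<Rightarrow>\<^sub>0 nat"
type_synonym fock = "mono \<Rightarrow>\<^sub>0 qfield"

definition heis_neg :: "nat \<Rightarrow> fock \<Rightarrow> fock" where
  "heis_neg r f = Poly_Mapping.single (Poly_Mapping.single (r - 1) 1) 1 * f"

definition heis_pos :: "nat \<Rightarrow> fock \<Rightarrow> fock" where
  "heis_pos r = lin_ext (\<lambda>\<mu>.
     fscale (qint (2 * int r) * qint (int r) / of_nat r * of_nat (Poly_Mapping.lookup \<mu> (r - 1)))
       (bas (\<mu> - Poly_Mapping.single (r - 1) 1)))"

text \<open>For operators \<open>g r\<close>, \<open>r \<ge> 1\<close>: \<open>ser_pow g k n\<close> is the coefficient of \<open>w\<^sup>n\<close> in the \<open>k\<close>-th power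
  of \<open>\<Sum>r\<ge>1. g r w\<^sup>r\<close>, and \<open>ser_exp g n\<close> is the coefficient of \<open>w\<^sup>n\<close> in its exponential (powers
  beyond the \<open>n\<close>-th do not contribute).\<close>

primrec ser_pow :: "(nat \<Rightarrow> fock \<Rightarrow> fock) \<Rightarrow> nat \<Rightarrow> nat \<Rightarrow> fock \<Rightarrow> fock" where
  "ser_pow g 0 n f = (if n = 0 then f else 0)"
| "ser_pow g (Suc k) n f = (\<Sum>r=1..n. g r (ser_pow g k (n - r) f))"

definition ser_exp :: "(nat \<Rightarrow> fock \<Rightarrow> fock) \<Rightarrow> nat \<Rightarrow> fock \<Rightarrow> fock" where
  "ser_exp g n f = (\<Sum>k\<le>n. fscale (1 / of_nat (fact k)) (ser_pow g k n f))"

definition Eminus :: "nat \<Rightarrow> fock \<Rightarrow> fock" where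
  "Eminus = ser_exp (\<lambda>r f. fscale (qhalf powi (- int r) / qint (int r)) (heis_neg r f))"

definition Eplus :: "nat \<Rightarrow> fock \<Rightarrow> fock" where
  "Eplus = ser_exp (\<lambda>r f. fscale (- (qhalf powi (- int r) / qint (int r))) (heis_pos r f))"

definition Ephi :: "nat \<Rightarrow> fock \<Rightarrow> fock" where
  "Ephi = ser_exp (\<lambda>r f. fscale (- (qpar - inverse qpar)) (heis_neg r f))"

text \<open>The label \<open>(\<mu>, b)\<close> is the basis vector \<open>\<mu> \<otimes> e\<^sup>\<beta>\<close> with \<open>\<beta> = b \<alpha>\<^sub>1\<close>, so \<open>(\<alpha>\<^sub>1, \<beta>) = 2 b\<close>.\<close>

type_synonym label = "mono \<times> int"

definition tens_e :: "fock \<Rightarrow> int \<Rightarrow> (label \<Rightarrow>\<^sub>0 qfield)" where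
  "tens_e f b = lin_ext (\<lambda>\<mu>. bas (\<mu>, b)) f"

definition xplus :: "(label \<Rightarrow>\<^sub>0 qfield) current" where
  "xplus n = lin_ext (\<lambda>(\<mu>, b).
     tens_e (Sum_any (\<lambda>(i::nat, j::nat).
               Eminus i (Eplus j (bas \<mu>)) when int i - int j + 2 * b = n))
            (b + 1))"

definition phi :: "(label \<Rightarrow>\<^sub>0 qfield) current" where
  "phi n = lin_ext (\<lambda>(\<mu>, b).
     if n \<ge> 0 then fscale (qpar powi (- (2 * b))) (tens_e (Ephi (nat n) (bas \<mu>)) b) else 0)"

text \<open>The tensor power with \<open>c\<close> factors is indexed by a finite linearly ordered type with \<open>c\<close>
  elements, whose order is the order of the factors. Its basis consists of the functions
  from this type to \<open>label\<close>.\<close>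

type_synonym 'c tens = "('c \<Rightarrow> label) \<Rightarrow>\<^sub>0 qfield"

definition pure_tensor :: "('c::finite \<Rightarrow> (label \<Rightarrow>\<^sub>0 qfield)) \<Rightarrow> 'c tens" where
  "pure_tensor w =
     (\<Sum>h\<in>{h. \<forall>i. h i \<in> Poly_Mapping.keys (w i)}.
        Poly_Mapping.single h (\<Prod>i\<in>UNIV. Poly_Mapping.lookup (w i) (h i)))"

definition tensor_current ::
    "('c::finite \<Rightarrow> (label \<Rightarrow>\<^sub>0 qfield) current) \<Rightarrow> 'c tens current" where
  "tensor_current a n = lin_ext (\<lambda>h.
     Sum_any (\<lambda>\<nu> :: 'c \<Rightarrow> int.
       pure_tensor (\<lambda>i. a i (\<nu> i) (bas (h i))) when (\<Sum>i\<in>UNIV. \<nu> i) = n))"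

text \<open>Here \<open>pos i\<close> is the number of factors to the left of \<open>i\<close>, so the \<open>l\<close>-th factor (counted from
  \<open>1\<close>) has \<open>pos = l - 1\<close>.\<close>

definition pos :: "'c::{finite,linorder} \<Rightarrow> nat" where
  "pos i = card {j. j < i}"

definition x_current :: "'c::{finite,linorder} tens current" where
  "x_current = (\<Sum>l\<in>UNIV. tensor_current (\<lambda>i::'c.
     if i < l then cur.dil (qhalf ^ (2 * pos i + 1)) phi
     else if i = l then cur.dil (qpar ^ pos l) xplus
     else cur.id_current))"


section \<open>The algebra generated by the current, and its character\<close>

type_synonym 'c elt = "nat \<Rightarrow>\<^sub>0 'c tens current"

definition Vc1 :: "'c::{finite,linorder} elt set" where
  "Vc1 = (LEAST V. cur.qva_in_Et V \<and> Poly_Mapping.single 1 x_current \<in> V)"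

definition x_power :: "nat \<Rightarrow> 'c::{finite,linorder} elt" where
  "x_power m = ((cur.nth_prod (Poly_Mapping.single 1 x_current) (- 1)) ^^ m) cur.vacuum"

text \<open>The list \<open>[(m\<^sub>1, r\<^sub>1), \<dots>, (m\<^sub>k, r\<^sub>k)]\<close> indexes a basis element. List positions start at \<open>0\<close>,
  so the pair at position \<open>j\<close> contributes \<open>-(j+1) r\<close> to the degree. The degree is attached to the
  list; it is a degree of the element because distinct lists give distinct basis elements, which
  is part of the basis property of \<open>monomial_elt ` basis_data c\<close> in \<open>Vc1\<close>.\<close>

definition monomial_elt :: "(nat \<times> int) list \<Rightarrow> 'c::{finite,linorder} elt" where
  "monomial_elt ds = foldr (\<lambda>(m, r). cur.nth_prod (x_power m) r) ds cur.vacuum"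

definition basis_data :: "nat \<Rightarrow> (nat \<times> int) list set" where
  "basis_data c =
     {ds. \<forall>j<length ds. 1 \<le> fst (ds ! j) \<and> fst (ds ! j) \<le> c \<and>
            snd (ds ! j) \<le> (if j = length ds - 1 then - 1 else - 2)}"

definition data_degree :: "(nat \<times> int) list \<Rightarrow> int" where
  "data_degree ds = - (\<Sum>j<length ds. (int j + 1) * snd (ds ! j))"

definition Vc1_deg :: "nat \<Rightarrow> 'c::{finite,linorder} elt set" where
  "Vc1_deg r =
     cur.Et.span (monomial_elt ` {ds \<in> basis_data (CARD('c)). data_degree ds = int r})"

definition char_Vc1 :: "'c::{finite,linorder} itself \<Rightarrow> rat fps" where
  "char_Vc1 _ = Abs_fps (\<lambda>r. of_nat (cur.Et.dim (Vc1_deg r :: 'c elt set)))"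

end

theory Submission
  imports Defs
begin

text \<open>The excess \<open>t\<^sub>j\<close> of \<open>- r\<^sub>j\<close> over its least allowed value is an arbitrary natural number and
  contributes \<open>j t\<^sub>j\<close> to the degree, while the least values themselves contribute \<open>k\<^sup>2\<close>. The excesses
  therefore account for the product of the \<open>1 / (1 - q\<^sup>j)\<close>, and the free choice of each \<open>m\<^sub>j\<close> for
  the factor \<open>c\<^sup>k\<close>.\<close>

section \<open>Counting coloured partitions\<close>

text \<open>The pair at position \<open>j\<close> is a colour together with the multiplicity of the
  part \<open>Suc j\<close>. These are partitions of \<open>n\<close> into parts of size at most
  \<open>k\<close>, with one of \<open>c\<close> colours for each size, whether or not it
  occurs.\<close>

definition weighted_lists :: "nat \<Rightarrow> nat \<Rightarrow> nat \<Rightarrow> (nat \<times> nat) list set" where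
  "weighted_lists c k n =
     {ts. length ts = k \<and> fst ` set ts \<subseteq> {1..c} \<and> (\<Sum>j<k. Suc j * snd (ts ! j)) = n}"

text \<open>All weights are at least 1, so no multiplicity exceeds \<open>n\<close>. Finiteness
  matters because \<open>card\<close> of an infinite set is 0.\<close>

lemma finite_weighted_lists: "finite (weighted_lists c k n)"
proof (rule finite_subset)
  show "weighted_lists c k n \<subseteq> {ts. set ts \<subseteq> {1..c} \<times> {..n} \<and> length ts = k}"
  proof (intro subsetI CollectI conjI)
    fix ts p assume ts: "ts \<in> weighted_lists c k n" and p: "p \<in> set ts"
    then obtain j where j: "j < k" "p = ts ! j"
      by (auto simp: weighted_lists_def in_set_conv_nth)
    have "snd p \<le> Suc j * snd (ts ! j)"
      using j by simp
    also have "\<dots> \<le> (\<Sum>j<k. Suc j * snd (ts ! j))"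
      using j by (intro member_le_sum) auto
    finally show "p \<in> {1..c} \<times> {..n}"
      using ts p by (cases p) (auto simp: weighted_lists_def)
  qed (auto simp: weighted_lists_def)
  show "finite {ts. set ts \<subseteq> {1..c} \<times> {..n} \<and> length ts = k}"
    by (rule finite_lists_length_eq) auto
qed

lemma weighted_lists_0: "weighted_lists c 0 n = (if n = 0 then {[]} else {})"
  by (auto simp: weighted_lists_def)

lemma snoc_in_weighted_lists:
  "ts @ [(m, t)] \<in> weighted_lists c (Suc k) n \<longleftrightarrow>
     m \<in> {1..c} \<and> Suc k * t \<le> n \<and> ts \<in> weighted_lists c k (n - Suc k * t)"
proof -
  have "(\<Sum>j<Suc k. Suc j * snd ((ts @ [(m, t)]) ! j)) =
        (\<Sum>j<k. Suc j * snd (ts ! j)) + Suc k * t" if "length ts = k"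
    using that by (simp add: nth_append)
  then show ?thesis
    unfolding weighted_lists_def by auto
qed

lemma weighted_lists_SucE:
  assumes "us \<in> weighted_lists c (Suc k) n"
  obtains ts m t where "us = ts @ [(m, t)]"
proof (cases us rule: rev_cases)
  case Nil
  then show ?thesis using assms by (simp add: weighted_lists_def)
next
  case (snoc ts p)
  then show ?thesis using that by (cases p) auto
qed

text \<open>The usual recurrence on the largest admissible part. Either \<open>Suc k\<close> has
  multiplicity 0, and deleting the last entry forgets one of \<open>c\<close> colours, or one copy
  of that part can be removed. The sets \<open>zero\<close> and \<open>positive\<close> are these
  two cases.\<close>

lemma card_weighted_lists_Suc:
  "card (weighted_lists c (Suc k) n) =
     c * card (weighted_lists c k n) +
     (if Suc k \<le> n then card (weighted_lists c (Suc k) (n - Suc k)) else 0)"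
proof -
  define zero where "zero = (\<lambda>(m::nat, ts). ts @ [(m, 0::nat)]) ` ({1..c} \<times> weighted_lists c k n)"
  define bump where "bump = (\<lambda>us :: (nat \<times> nat) list. butlast us @ [apsnd Suc (last us)])"
  define positive where
    "positive = (if Suc k \<le> n then bump ` weighted_lists c (Suc k) (n - Suc k) else {})"
  have "weighted_lists c (Suc k) n = zero \<union> positive"
  proof (intro equalityI subsetI)
    fix us assume us: "us \<in> weighted_lists c (Suc k) n"
    then obtain ts m t where eq: "us = ts @ [(m, t)]"
      by (rule weighted_lists_SucE)
    show "us \<in> zero \<union> positive"
    proof (cases t)
      case 0
      then have "us \<in> zero"
        using us unfolding eq snoc_in_weighted_lists zero_def by force
      then show ?thesis ..
    next
      case (Suc t')
      have "ts @ [(m, t')] \<in> weighted_lists c (Suc k) (n - Suc k)" "Suc k \<le> n"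
        using us unfolding eq snoc_in_weighted_lists Suc by (auto simp: algebra_simps)
      moreover have "us = bump (ts @ [(m, t')])"
        by (simp add: bump_def eq Suc)
      ultimately have "us \<in> positive"
        unfolding positive_def by simp
      then show ?thesis ..
    qed
  next
    fix us assume "us \<in> zero \<union> positive"
    then show "us \<in> weighted_lists c (Suc k) n"
    proof
      assume "us \<in> zero"
      then show ?thesis
        unfolding zero_def by (auto simp: snoc_in_weighted_lists)
    next
      assume "us \<in> positive"
      then obtain vs where vs: "Suc k \<le> n" "vs \<in> weighted_lists c (Suc k) (n - Suc k)" "us = bump vs"
        unfolding positive_def by (auto split: if_splits)
      from vs(2) obtain ts m t where eq: "vs = ts @ [(m, t)]"
        by (rule weighted_lists_SucE)
      have "us = ts @ [(m, Suc t)]"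
        by (simp add: vs(3) eq bump_def)
      then show ?thesis
        using vs(1,2) unfolding eq by (auto simp: snoc_in_weighted_lists algebra_simps)
    qed
  qed
  moreover have "zero \<inter> positive = {}"
    unfolding zero_def positive_def bump_def by (auto simp: apsnd_def map_prod_def split: prod.splits)
  moreover have "finite zero" "finite positive"
    by (auto simp: zero_def positive_def finite_weighted_lists)
  moreover have "card zero = c * card (weighted_lists c k n)"
    unfolding zero_def by (subst card_image) (auto simp: inj_on_def card_cartesian_product)
  moreover have "inj_on bump (weighted_lists c (Suc k) (n - Suc k))"
  proof (rule inj_onI)
    fix us vs assume "us \<in> weighted_lists c (Suc k) (n - Suc k)"
      "vs \<in> weighted_lists c (Suc k) (n - Suc k)" and eq: "bump us = bump vs"
    then obtain ts m t ts' m' t' where "us = ts @ [(m, t)]" "vs = ts' @ [(m', t')]"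
      by (metis weighted_lists_SucE)
    with eq show "us = vs"
      by (simp add: bump_def)
  qed
  then have "card positive = (if Suc k \<le> n then card (weighted_lists c (Suc k) (n - Suc k)) else 0)"
    by (simp add: positive_def card_image)
  ultimately show ?thesis
    by (simp add: card_Un_disjoint)
qed

text \<open>By the recurrence, multiplying the series for \<open>Suc k\<close> by
  \<open>1 - fps_X ^ Suc k\<close> gives \<open>c\<close> times the series for \<open>k\<close>.
  Keeping the product on the left makes the induction free of division.\<close>

lemma weighted_lists_genfun:
  "Abs_fps (\<lambda>n. of_nat (card (weighted_lists c k n)) :: 'a::field) * (\<Prod>i=1..k. 1 - fps_X ^ i)
     = of_nat c ^ k"
proof (induction k)
  case 0
  show ?case
    by (rule fps_ext) (simp add: weighted_lists_0)
next
  case (Suc k)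
  let ?W = "\<lambda>k. Abs_fps (\<lambda>n. of_nat (card (weighted_lists c k n)) :: 'a)"
  \<comment> \<open>The conditional term of the recurrence is a shift by
    \<open>fps_X ^ Suc k\<close>, a power that must stay folded for its coefficient rule to
    apply.\<close>
  have "?W (Suc k) = of_nat c * ?W k + fps_X ^ Suc k * ?W (Suc k)"
    by (rule fps_ext)
      (simp add: card_weighted_lists_Suc fps_X_power_mult_nth fps_mult_of_nat_nth
        del: power_Suc)
  then have step: "?W (Suc k) * (1 - fps_X ^ Suc k) = of_nat c * ?W k"
    by (simp add: algebra_simps)
  have "?W (Suc k) * (\<Prod>i=1..Suc k. 1 - fps_X ^ i) =
        ?W (Suc k) * (1 - fps_X ^ Suc k) * (\<Prod>i=1..k. 1 - fps_X ^ i)"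
    by (simp add: mult_ac del: power_Suc)
  also have "\<dots> = of_nat c * (?W k * (\<Prod>i=1..k. 1 - fps_X ^ i))"
    by (simp only: step mult.assoc)
  finally show ?case
    by (simp only: Suc.IH power_Suc)
qed

section \<open>Basis data as extremal modes plus excesses\<close>

definition add_extremal :: "(nat \<times> nat) list \<Rightarrow> (nat \<times> int) list" where
  "add_extremal ts = map (\<lambda>j. (fst (ts ! j),
     - int (snd (ts ! j)) - (if j = length ts - 1 then 1 else 2))) [0..<length ts]"

text \<open>The sum is \<open>2 * (1 + ... + (k - 1)) + k\<close>. For \<open>k = 0\<close> the
  truncated \<open>k - 1\<close> is harmless, as there are no terms.\<close>

lemma sum_extremal: "(\<Sum>j<k. (int j + 1) * (if j = k - 1 then 1 else 2)) = int (k\<^sup>2)"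
proof (cases k)
  case (Suc l)
  have "(\<Sum>j<l. (int j + 1) * 2) = int (l * (l + 1))"
    by (induction l) (auto simp: algebra_simps)
  moreover have "(\<Sum>j<l. (int j + 1) * (if j = l then 1 else 2)) = (\<Sum>j<l. (int j + 1) * 2)"
    by (rule sum.cong) auto
  ultimately show ?thesis
    by (simp add: Suc power2_eq_square algebra_simps)
qed simp

lemma data_degree_add_extremal:
  "data_degree (add_extremal ts) = int ((length ts)\<^sup>2 + (\<Sum>j<length ts. Suc j * snd (ts ! j)))"
proof -
  have "data_degree (add_extremal ts) =
        (\<Sum>j<length ts. (int j + 1) * (if j = length ts - 1 then 1 else 2)
                        + int (Suc j * snd (ts ! j)))"
    unfolding data_degree_def add_extremal_def sum_negf [symmetric]
    by (rule sum.cong) (auto simp: algebra_simps)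
  then show ?thesis
    unfolding sum.distrib sum_extremal by simp
qed

lemma bij_betw_add_extremal:
  "bij_betw add_extremal (weighted_lists c k n)
     {ds \<in> basis_data c. length ds = k \<and> data_degree ds = int (k\<^sup>2 + n)}"
proof -
  define sub_extremal :: "(nat \<times> int) list \<Rightarrow> (nat \<times> nat) list" where
    "sub_extremal ds = map (\<lambda>j. (fst (ds ! j),
       nat (- snd (ds ! j) - (if j = length ds - 1 then 1 else 2)))) [0..<length ds]" for ds
  have sub_add: "sub_extremal (add_extremal ts) = ts" for ts
    by (rule nth_equalityI) (auto simp: sub_extremal_def add_extremal_def)
  \<comment> \<open>Only this direction needs membership in \<open>basis_data\<close>: the bounds on
    the modes keep the argument of \<open>nat\<close> nonnegative, so nothing is truncated.\<close>
  have add_sub: "add_extremal (sub_extremal ds) = ds" if "ds \<in> basis_data c" for ds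
  proof (rule nth_equalityI)
    fix j assume "j < length (add_extremal (sub_extremal ds))"
    then have j: "j < length ds"
      by (simp add: sub_extremal_def add_extremal_def)
    then have "snd (ds ! j) \<le> (if j = length ds - 1 then - 1 else - 2)"
      using that by (simp add: basis_data_def)
    then show "add_extremal (sub_extremal ds) ! j = ds ! j"
      using j by (cases "j = length ds - 1") (simp_all add: sub_extremal_def add_extremal_def prod_eq_iff)
  qed (simp add: sub_extremal_def add_extremal_def)
  show ?thesis
  proof (rule bij_betw_byWitness [where f' = sub_extremal])
    show "\<forall>ts\<in>weighted_lists c k n. sub_extremal (add_extremal ts) = ts"
      by (simp add: sub_add)
    show "\<forall>ds\<in>{ds \<in> basis_data c. length ds = k \<and> data_degree ds = int (k\<^sup>2 + n)}.
            add_extremal (sub_extremal ds) = ds"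
      by (simp add: add_sub)
    show "add_extremal ` weighted_lists c k n
            \<subseteq> {ds \<in> basis_data c. length ds = k \<and> data_degree ds = int (k\<^sup>2 + n)}"
    proof (intro image_subsetI CollectI conjI)
      fix ts assume ts: "ts \<in> weighted_lists c k n"
      then have "fst (ts ! j) \<in> {1..c}" if "j < length ts" for j
        using that by (force simp: weighted_lists_def)
      then show "add_extremal ts \<in> basis_data c"
        by (auto simp: basis_data_def add_extremal_def)
      show "length (add_extremal ts) = k"
        using ts by (simp add: add_extremal_def weighted_lists_def)
      show "data_degree (add_extremal ts) = int (k\<^sup>2 + n)"
        using ts by (simp only: data_degree_add_extremal weighted_lists_def) simp
    qed
    show "sub_extremal ` {ds \<in> basis_data c. length ds = k \<and> data_degree ds = int (k\<^sup>2 + n)}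
            \<subseteq> weighted_lists c k n"
    proof (intro image_subsetI)
      fix ds assume "ds \<in> {ds \<in> basis_data c. length ds = k \<and> data_degree ds = int (k\<^sup>2 + n)}"
      then have ds: "ds \<in> basis_data c" "length ds = k" "data_degree ds = int (k\<^sup>2 + n)"
        by auto
      have len: "length (sub_extremal ds) = k"
        using ds by (simp add: sub_extremal_def)
      \<comment> \<open>The degree formula, applied to
        \<open>add_extremal (sub_extremal ds) = ds\<close>, determines the weight without a separate
        computation.\<close>
      have "int (k\<^sup>2 + (\<Sum>j<k. Suc j * snd (sub_extremal ds ! j))) = int (k\<^sup>2 + n)"
        using data_degree_add_extremal [of "sub_extremal ds"] ds len by (simp only: add_sub)
      then have "(\<Sum>j<k. Suc j * snd (sub_extremal ds ! j)) = n"
        by (simp only: of_nat_eq_iff add_left_cancel)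
      moreover have "fst ` set (sub_extremal ds) \<subseteq> {1..c}"
        using ds by (auto simp: sub_extremal_def basis_data_def)
      ultimately show "sub_extremal ds \<in> weighted_lists c k n"
        using len by (simp add: weighted_lists_def)
    qed
  qed
qed

text \<open>Termwise comparison with the extremal modes. This bounds the length of the data in a
  given degree.\<close>

lemma length_square_le_data_degree:
  assumes "ds \<in> basis_data c"
  shows "int ((length ds)\<^sup>2) \<le> data_degree ds"
proof -
  have "(\<Sum>j<length ds. (int j + 1) * (if j = length ds - 1 then 1 else 2))
        \<le> (\<Sum>j<length ds. (int j + 1) * - snd (ds ! j))"
    using assms by (intro sum_mono mult_left_mono) (force simp: basis_data_def)+
  then show ?thesis
    unfolding sum_extremal data_degree_def by (simp add: sum_negf)
qed

section \<open>The contribution of each length to the character\<close>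

definition basis_data_slice :: "nat \<Rightarrow> nat \<Rightarrow> nat \<Rightarrow> (nat \<times> int) list set" where
  "basis_data_slice c k r = {ds \<in> basis_data c. length ds = k \<and> data_degree ds = int r}"

lemma basis_data_slice_empty: "r < k\<^sup>2 \<Longrightarrow> basis_data_slice c k r = {}"
  using length_square_le_data_degree [of _ c] by (fastforce simp: basis_data_slice_def)

lemma finite_basis_data_slice: "finite (basis_data_slice c k r)"
proof (cases "r < k\<^sup>2")
  case False
  then show ?thesis
    using bij_betw_finite [OF bij_betw_add_extremal [of c k "r - k\<^sup>2"]]
    by (simp add: basis_data_slice_def finite_weighted_lists)
qed (simp add: basis_data_slice_empty)

lemma card_basis_data_slice:
  "card (basis_data_slice c k r) = (if r < k\<^sup>2 then 0 else card (weighted_lists c k (r - k\<^sup>2)))"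
  using bij_betw_same_card [OF bij_betw_add_extremal [of c k "r - k\<^sup>2"]]
  by (auto simp: basis_data_slice_empty) (auto simp: basis_data_slice_def)

text \<open>This is the term of index \<open>k\<close> in the character formula: the extremal modes
  shift the series of \<open>weighted_lists\<close> by \<open>k\<^sup>2\<close>.\<close>

lemma basis_data_slice_genfun:
  "Abs_fps (\<lambda>r. of_nat (card (basis_data_slice c k r)) :: 'a::field) =
     fps_X ^ (k\<^sup>2) / (\<Prod>i=1..k. 1 - fps_X ^ i) * of_nat c ^ k"
proof -
  let ?W = "Abs_fps (\<lambda>n. of_nat (card (weighted_lists c k n)) :: 'a)"
  let ?P = "\<Prod>i=1..k. 1 - fps_X ^ i :: 'a fps"
  \<comment> \<open>A nonzero constant term makes \<open>?P\<close> invertible, so that division by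
    it is multiplication by \<open>inverse ?P\<close>.\<close>
  have "fps_nth ?P 0 = 1"
    by (induction k) auto
  then have unit: "fps_nth ?P 0 \<noteq> 0"
    by simp
  have "Abs_fps (\<lambda>r. of_nat (card (basis_data_slice c k r)) :: 'a) = fps_X ^ (k\<^sup>2) * ?W"
    by (rule fps_ext) (simp add: card_basis_data_slice fps_X_power_mult_nth)
  also have "?W = of_nat c ^ k * inverse ?P"
    unfolding weighted_lists_genfun [symmetric] mult.assoc inverse_mult_eq_1' [OF unit] by simp
  finally show ?thesis
    unfolding fps_divide_unit [OF unit] by (simp only: mult_ac)
qed

text \<open>A nonempty slice has \<open>k \<le> k\<^sup>2 \<le> r\<close>, so every bound
  \<open>n > r\<close> captures all lengths. The freedom in \<open>n\<close> serves the partial sums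
  of the series.\<close>

lemma card_basis_data_degree:
  assumes "r < n"
  shows "card {ds \<in> basis_data c. data_degree ds = int r} = (\<Sum>k<n. card (basis_data_slice c k r))"
proof -
  have "length ds < n" if "ds \<in> basis_data c" "data_degree ds = int r" for ds
  proof -
    have "(length ds)\<^sup>2 \<le> r"
      using length_square_le_data_degree [OF that(1)] that(2) by simp
    then show ?thesis
      using assms by (meson le_less_trans power2_nat_le_imp_le)
  qed
  then have "{ds \<in> basis_data c. data_degree ds = int r} = (\<Union>k<n. basis_data_slice c k r)"
    by (auto simp: basis_data_slice_def)
  moreover have "card (\<Union>k<n. basis_data_slice c k r) = (\<Sum>k<n. card (basis_data_slice c k r))"
  proof (rule card_UN_disjoint)
    show "\<forall>i\<in>{..<n}. \<forall>j\<in>{..<n}. i \<noteq> j \<longrightarrow> basis_data_slice c i r \<inter> basis_data_slice c j r = {}"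
      by (auto simp: basis_data_slice_def)
  qed (simp_all add: finite_basis_data_slice)
  ultimately show ?thesis
    by simp
qed

text \<open>The assumptions express the known basis result for \<open>Vc1\<close>. Convergence is
  that of formal power series, obtained here from coefficients that are eventually constant.\<close>

theorem theorem3p13:
  assumes distinct_data:
      "inj_on (monomial_elt :: _ \<Rightarrow> 'c::{finite,linorder} elt) (basis_data (CARD('c)))"
    and independent:
      "\<not> cur.Et.dependent ((monomial_elt :: _ \<Rightarrow> 'c elt) ` basis_data (CARD('c)))"
    and spanning:
      "cur.Et.span (monomial_elt ` basis_data (CARD('c))) = (Vc1 :: 'c elt set)"
  shows "(\<lambda>r. fps_X ^ (r\<^sup>2) / (\<Prod>i=1..r. 1 - fps_X ^ i) * of_nat (CARD('c)) ^ r)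
           sums char_Vc1 TYPE('c)"
proof -
  \<comment> \<open>Independence turns the dimension into a number of elements, and injectivity
    turns that into a number of lists.\<close>
  have dim: "cur.Et.dim (Vc1_deg r :: 'c elt set) =
             card {ds \<in> basis_data (CARD('c)). data_degree ds = int r}" (is "_ = card ?D") for r
  proof -
    have "\<not> cur.Et.dependent ((monomial_elt :: _ \<Rightarrow> 'c elt) ` ?D)"
      using independent by (rule cur.Et.independent_mono) auto
    then have "cur.Et.dim (Vc1_deg r :: 'c elt set) = card ((monomial_elt :: _ \<Rightarrow> 'c elt) ` ?D)"
      unfolding Vc1_deg_def by (rule cur.Et.dim_span_eq_card_independent)
    also have "\<dots> = card ?D"
      using distinct_data by (intro card_image) (auto intro: inj_on_subset)
    finally show ?thesis .
  qed
  \<comment> \<open>Each summand is rewritten as the counting series of a slice, so that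
    coefficients can be compared.\<close>
  show ?thesis
    unfolding sums_def basis_data_slice_genfun [symmetric]
  proof (rule tendsto_fpsI)
    fix r
    show "\<forall>\<^sub>F n in sequentially.
            fps_nth (\<Sum>k<n. Abs_fps (\<lambda>r. of_nat (card (basis_data_slice (CARD('c)) k r)))) r
              = fps_nth (char_Vc1 TYPE('c)) r"
      \<comment> \<open>Once \<open>n > r\<close>, the coefficient of index \<open>r\<close> is
        final, since data of length at least \<open>n\<close> has degree above
        \<open>r\<close>.\<close>
      using eventually_gt_at_top [of r]
      by eventually_elim (simp add: fps_sum_nth char_Vc1_def dim card_basis_data_degree)
  qed
qed

end
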